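(* Let $A$ be a finite-dimensional algebra over an algebraically closed field $K$, with enveloping algebra $A^e=A\otimes_K A^{op}$. Then $$\operatorname{idim}_{A^e}({}_{A^e}A)=\operatorname{idim}_{A^e}(A_{A^e}).$$
   Context: $\operatorname{idim}$ denotes injective dimension. ${}_{A^e}A$ denotes $A$ as a left $A^e$-module, $(x\otimes y)\cdot a=xay$, and $A_{A^e}$ denotes $A$ as a right $A^e$-module, $a\cdot(x\otimes y)=yax$. *)

theory Defs
  imports "HOL-Algebra.Algebra" "HOL-Library.Extended_Nat"
begin

section \<open>Algebras over a field\<close>

text \<open>The locale \<open>algebra\<close> of HOL-Algebra is restricted to commutative algebras; here the
  multiplication of \<^term>\<open>A\<close> is an arbitrary unital associative one.\<close>

locale K_algebra = K?: field K + A?: ring A + module K A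
  for K :: "('k, 'm) ring_scheme" (structure) and A :: "('k, 'a, 'n) module_scheme" (structure) +
  assumes smult_mult_left:
      "\<lbrakk>k \<in> carrier K; x \<in> carrier A; y \<in> carrier A\<rbrakk>
        \<Longrightarrow> (k \<odot>\<^bsub>A\<^esub> x) \<otimes>\<^bsub>A\<^esub> y = k \<odot>\<^bsub>A\<^esub> (x \<otimes>\<^bsub>A\<^esub> y)"
    and smult_mult_right:
      "\<lbrakk>k \<in> carrier K; x \<in> carrier A; y \<in> carrier A\<rbrakk>
        \<Longrightarrow> x \<otimes>\<^bsub>A\<^esub> (k \<odot>\<^bsub>A\<^esub> y) = k \<odot>\<^bsub>A\<^esub> (x \<otimes>\<^bsub>A\<^esub> y)"

locale fin_dim_K_algebra = K_algebra +
  assumes finite_spanning_set: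
    "\<exists>S. finite S \<and> S \<subseteq> carrier A \<and>
       (\<forall>x\<in>carrier A. \<exists>c\<in>S \<rightarrow> carrier K. x = (\<Oplus>\<^bsub>A\<^esub>s\<in>S. c s \<odot>\<^bsub>A\<^esub> s))"

definition opposite :: "('a, 'm) ring_scheme \<Rightarrow> ('a, 'm) ring_scheme"
  where "opposite R = R\<lparr>monoid.mult := \<lambda>x y. y \<otimes>\<^bsub>R\<^esub> x\<rparr>"


section \<open>Tensor products of algebras\<close>

text \<open>The monoid algebra \<open>K[G]\<close>: finitely supported functions with the convolution product.
  For an element \<^term>\<open>g\<close> of \<open>G\<close> and a scalar \<^term>\<open>k\<close>, \<open>fsingle K g k\<close> is the
  formal multiple \<open>k\<cdot>g\<close>.\<close>

definition fsupp :: "('k, 'm) ring_scheme \<Rightarrow> ('g \<Rightarrow> 'k) \<Rightarrow> 'g set"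
  where "fsupp K f = {g. f g \<noteq> \<zero>\<^bsub>K\<^esub>}"

definition fsingle :: "('k, 'm) ring_scheme \<Rightarrow> 'g \<Rightarrow> 'k \<Rightarrow> 'g \<Rightarrow> 'k"
  where "fsingle K g k = (\<lambda>h. if h = g then k else \<zero>\<^bsub>K\<^esub>)"

definition monoid_algebra ::
    "('k, 'm) ring_scheme \<Rightarrow> ('g, 'n) monoid_scheme \<Rightarrow> ('g \<Rightarrow> 'k) ring"
  where "monoid_algebra K G =
    \<lparr>carrier = {f. range f \<subseteq> carrier K \<and> finite (fsupp K f) \<and> fsupp K f \<subseteq> carrier G},
     monoid.mult = (\<lambda>f g z. \<Oplus>\<^bsub>K\<^esub>p \<in> {p \<in> fsupp K f \<times> fsupp K g. fst p \<otimes>\<^bsub>G\<^esub> snd p = z}.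
               f (fst p) \<otimes>\<^bsub>K\<^esub> g (snd p)),
     one = fsingle K \<one>\<^bsub>G\<^esub> \<one>\<^bsub>K\<^esub>,
     ring.zero = (\<lambda>_. \<zero>\<^bsub>K\<^esub>),
     add = (\<lambda>f g z. f z \<oplus>\<^bsub>K\<^esub> g z)\<rparr>"

text \<open>\<open>A \<otimes>\<^sub>K B\<close> is the free \<open>K\<close>-module on \<open>A \<times> B\<close> modulo the submodule spanned by the
  bilinearity relations. The set of these relations is closed, up to scalars, under
  multiplication by elements of the basis \<open>A \<times> B\<close>, so that this submodule is the ideal of
  the monoid algebra \<open>K[A \<times> B]\<close> generated by them, and the multiplication
  \<open>(a \<otimes> b)(a' \<otimes> b') = aa' \<otimes> bb'\<close> is the one of the quotient ring.\<close>

definition tensor_relations ::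
    "('k, 'm) ring_scheme \<Rightarrow> ('k, 'a, 'n) module_scheme \<Rightarrow> ('k, 'b, 'l) module_scheme
      \<Rightarrow> ('a \<times> 'b \<Rightarrow> 'k) set"
  where "tensor_relations K A B =
    (let F = monoid_algebra K (A \<times>\<times> B); e = (\<lambda>a b. fsingle K (a, b) \<one>\<^bsub>K\<^esub>) in
      {e (a \<oplus>\<^bsub>A\<^esub> a') b \<ominus>\<^bsub>F\<^esub> (e a b \<oplus>\<^bsub>F\<^esub> e a' b) | a a' b.
         a \<in> carrier A \<and> a' \<in> carrier A \<and> b \<in> carrier B} \<union>
      {e a (b \<oplus>\<^bsub>B\<^esub> b') \<ominus>\<^bsub>F\<^esub> (e a b \<oplus>\<^bsub>F\<^esub> e a b') | a b b'.
         a \<in> carrier A \<and> b \<in> carrier B \<and> b' \<in> carrier B} \<union>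
      {e (k \<odot>\<^bsub>A\<^esub> a) b \<ominus>\<^bsub>F\<^esub> fsingle K (a, b) k | k a b.
         k \<in> carrier K \<and> a \<in> carrier A \<and> b \<in> carrier B} \<union>
      {e a (k \<odot>\<^bsub>B\<^esub> b) \<ominus>\<^bsub>F\<^esub> fsingle K (a, b) k | k a b.
         k \<in> carrier K \<and> a \<in> carrier A \<and> b \<in> carrier B})"

definition tensor_ideal ::
    "('k, 'm) ring_scheme \<Rightarrow> ('k, 'a, 'n) module_scheme \<Rightarrow> ('k, 'b, 'l) module_scheme
      \<Rightarrow> ('a \<times> 'b \<Rightarrow> 'k) set"
  where "tensor_ideal K A B =
    Idl\<^bsub>monoid_algebra K (A \<times>\<times> B)\<^esub> (tensor_relations K A B)"

definition tensor_algebra ::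
    "('k, 'm) ring_scheme \<Rightarrow> ('k, 'a, 'n) module_scheme \<Rightarrow> ('k, 'b, 'l) module_scheme
      \<Rightarrow> ('a \<times> 'b \<Rightarrow> 'k) set ring"
  where "tensor_algebra K A B = monoid_algebra K (A \<times>\<times> B) Quot tensor_ideal K A B"

definition pure_tensor ::
    "('k, 'm) ring_scheme \<Rightarrow> ('k, 'a, 'n) module_scheme \<Rightarrow> ('k, 'b, 'l) module_scheme
      \<Rightarrow> 'a \<Rightarrow> 'b \<Rightarrow> ('a \<times> 'b \<Rightarrow> 'k) set"
  where "pure_tensor K A B a b =
    tensor_ideal K A B +>\<^bsub>monoid_algebra K (A \<times>\<times> B)\<^esub> fsingle K (a, b) \<one>\<^bsub>K\<^esub>"

definition enveloping_algebra ::
    "('k, 'm) ring_scheme \<Rightarrow> ('k, 'a, 'n) module_scheme \<Rightarrow> ('a \<times> 'a \<Rightarrow> 'k) set ring"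
  where "enveloping_algebra K A = tensor_algebra K A (opposite A)"


section \<open>Left and right modules\<close>

text \<open>As in the locale \<open>module\<close>, the fields \<open>mult\<close> and \<open>one\<close> of the record of a module are
  irrelevant. For a right module \<^term>\<open>M\<close>, \<open>r \<odot>\<^bsub>M\<^esub> x\<close> stands for \<open>x \<cdot> r\<close>.\<close>

locale left_module = R?: ring R + M?: abelian_group M
  for R :: "('r, 'm) ring_scheme" (structure) and M :: "('r, 'x, 'n) module_scheme" (structure) +
  assumes smult_closed:
      "\<lbrakk>r \<in> carrier R; x \<in> carrier M\<rbrakk> \<Longrightarrow> r \<odot>\<^bsub>M\<^esub> x \<in> carrier M"
    and smult_add_ring:
      "\<lbrakk>r \<in> carrier R; s \<in> carrier R; x \<in> carrier M\<rbrakk>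
        \<Longrightarrow> (r \<oplus>\<^bsub>R\<^esub> s) \<odot>\<^bsub>M\<^esub> x = r \<odot>\<^bsub>M\<^esub> x \<oplus>\<^bsub>M\<^esub> s \<odot>\<^bsub>M\<^esub> x"
    and smult_add_module:
      "\<lbrakk>r \<in> carrier R; x \<in> carrier M; y \<in> carrier M\<rbrakk>
        \<Longrightarrow> r \<odot>\<^bsub>M\<^esub> (x \<oplus>\<^bsub>M\<^esub> y) = r \<odot>\<^bsub>M\<^esub> x \<oplus>\<^bsub>M\<^esub> r \<odot>\<^bsub>M\<^esub> y"
    and smult_assoc:
      "\<lbrakk>r \<in> carrier R; s \<in> carrier R; x \<in> carrier M\<rbrakk>
        \<Longrightarrow> (r \<otimes>\<^bsub>R\<^esub> s) \<odot>\<^bsub>M\<^esub> x = r \<odot>\<^bsub>M\<^esub> (s \<odot>\<^bsub>M\<^esub> x)"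
    and smult_one: "x \<in> carrier M \<Longrightarrow> \<one>\<^bsub>R\<^esub> \<odot>\<^bsub>M\<^esub> x = x"

locale right_module = R?: ring R + M?: abelian_group M
  for R :: "('r, 'm) ring_scheme" (structure) and M :: "('r, 'x, 'n) module_scheme" (structure) +
  assumes smult_closed:
      "\<lbrakk>r \<in> carrier R; x \<in> carrier M\<rbrakk> \<Longrightarrow> r \<odot>\<^bsub>M\<^esub> x \<in> carrier M"
    and smult_add_ring:
      "\<lbrakk>r \<in> carrier R; s \<in> carrier R; x \<in> carrier M\<rbrakk>
        \<Longrightarrow> (r \<oplus>\<^bsub>R\<^esub> s) \<odot>\<^bsub>M\<^esub> x = r \<odot>\<^bsub>M\<^esub> x \<oplus>\<^bsub>M\<^esub> s \<odot>\<^bsub>M\<^esub> x"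
    and smult_add_module:
      "\<lbrakk>r \<in> carrier R; x \<in> carrier M; y \<in> carrier M\<rbrakk>
        \<Longrightarrow> r \<odot>\<^bsub>M\<^esub> (x \<oplus>\<^bsub>M\<^esub> y) = r \<odot>\<^bsub>M\<^esub> x \<oplus>\<^bsub>M\<^esub> r \<odot>\<^bsub>M\<^esub> y"
    and smult_assoc:
      "\<lbrakk>r \<in> carrier R; s \<in> carrier R; x \<in> carrier M\<rbrakk>
        \<Longrightarrow> (r \<otimes>\<^bsub>R\<^esub> s) \<odot>\<^bsub>M\<^esub> x = s \<odot>\<^bsub>M\<^esub> (r \<odot>\<^bsub>M\<^esub> x)"
    and smult_one: "x \<in> carrier M \<Longrightarrow> \<one>\<^bsub>R\<^esub> \<odot>\<^bsub>M\<^esub> x = x"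

definition module_hom ::
    "('r, 'm) ring_scheme \<Rightarrow> ('r, 'x, 'n) module_scheme \<Rightarrow> ('r, 'y, 'l) module_scheme \<Rightarrow> ('x \<Rightarrow> 'y) set"
  where "module_hom R M N =
    {f \<in> carrier M \<rightarrow> carrier N.
       (\<forall>x\<in>carrier M. \<forall>y\<in>carrier M. f (x \<oplus>\<^bsub>M\<^esub> y) = f x \<oplus>\<^bsub>N\<^esub> f y) \<and>
       (\<forall>r\<in>carrier R. \<forall>x\<in>carrier M. f (r \<odot>\<^bsub>M\<^esub> x) = r \<odot>\<^bsub>N\<^esub> f x)}"


section \<open>Injective dimension\<close>

text \<open>The parameter \<open>C\<close> is the class of modules under consideration: it is
  \<open>left_module R\<close> or \<open>right_module R\<close>. The test modules have the same element type
  as the module tested for injectivity; by Baer's criterion this is no restriction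
  as soon as \<open>R\<close> and its one-sided ideals have isomorphic copies in that type.\<close>

definition injective_in ::
    "(('r, 'u) module \<Rightarrow> bool) \<Rightarrow> ('r, 'm) ring_scheme \<Rightarrow> ('r, 'u) module \<Rightarrow> bool"
  where "injective_in C R I \<longleftrightarrow> C I \<and>
    (\<forall>M N f g. C M \<and> C N \<and> f \<in> module_hom R M N \<and> inj_on f (carrier M) \<and> g \<in> module_hom R M I
       \<longrightarrow> (\<exists>h\<in>module_hom R N I. \<forall>x\<in>carrier M. h (f x) = g x))"

text \<open>Exactness of \<open>0 \<rightarrow> M \<rightarrow> I\<^sup>0 \<rightarrow> I\<^sup>1 \<rightarrow> \<dots>\<close> with all \<open>I\<^sup>n\<close> injective.\<close>

definition injective_resolution ::
    "(('r, 'u) module \<Rightarrow> bool) \<Rightarrow> ('r, 'm) ring_scheme \<Rightarrow> ('r, 'x) module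
      \<Rightarrow> (nat \<Rightarrow> ('r, 'u) module) \<Rightarrow> ('x \<Rightarrow> 'u) \<Rightarrow> (nat \<Rightarrow> 'u \<Rightarrow> 'u) \<Rightarrow> bool"
  where "injective_resolution C R M I \<epsilon> d \<longleftrightarrow>
    (\<forall>n. injective_in C R (I n)) \<and>
    \<epsilon> \<in> module_hom R M (I 0) \<and> (\<forall>n. d n \<in> module_hom R (I n) (I (Suc n))) \<and>
    inj_on \<epsilon> (carrier M) \<and>
    a_kernel (I 0) (I 1) (d 0) = \<epsilon> ` carrier M \<and>
    (\<forall>n. a_kernel (I (Suc n)) (I (Suc (Suc n))) (d (Suc n)) = d n ` carrier (I n))"

text \<open>The modules of the resolutions are taken from a fixed universe. It is large enough for
  arbitrary \<open>R\<close> and \<open>M\<close>: its cardinality is \<open>2\<^sup>\<kappa>\<close> for an infinite \<open>\<kappa>\<close> that is at least the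
  cardinalities of \<open>R\<close> and \<open>M\<close>, and a module with at most \<open>2\<^sup>\<kappa>\<close> elements has an injective
  hull with at most \<open>(2\<^sup>\<kappa>)\<^bsup>|R|\<^esup> = 2\<^sup>\<kappa>\<close> elements. Hence minimal injective resolutions exist
  within the universe, and it contains copies of \<open>R\<close> and its one-sided ideals.\<close>

type_synonym ('r, 'x) module_universe = "('r + 'x + nat) set"

definition inj_dim_in ::
    "(('r, ('r, 'x) module_universe) module \<Rightarrow> bool) \<Rightarrow> ('r, 'm) ring_scheme
      \<Rightarrow> ('r, 'x) module \<Rightarrow> enat"
  where "inj_dim_in C R M =
    Inf {enat n | n. \<exists>I \<epsilon> d. injective_resolution C R M I \<epsilon> d \<and>
                            (\<forall>i>n. carrier (I i) = {\<zero>\<^bsub>I i\<^esub>})}"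

definition left_inj_dim :: "('r, 'm) ring_scheme \<Rightarrow> ('r, 'x) module \<Rightarrow> enat"
  where "left_inj_dim R M = inj_dim_in (left_module R) R M"

definition right_inj_dim :: "('r, 'm) ring_scheme \<Rightarrow> ('r, 'x) module \<Rightarrow> enat"
  where "right_inj_dim R M = inj_dim_in (right_module R) R M"


section \<open>The algebra as a module over its enveloping algebra\<close>

text \<open>A class \<open>\<Sum> k\<^sub>i (x\<^sub>i \<otimes> y\<^sub>i)\<close> acts by \<open>a \<mapsto> \<Sum> k\<^sub>i x\<^sub>i a y\<^sub>i\<close> from the left and by
  \<open>a \<mapsto> \<Sum> k\<^sub>i y\<^sub>i a x\<^sub>i\<close> from the right, for every representative \<^term>\<open>f\<close> of the class.\<close>

definition enveloping_left_module ::
    "('k, 'm) ring_scheme \<Rightarrow> ('k, 'a, 'n) module_scheme \<Rightarrow> (('a \<times> 'a \<Rightarrow> 'k) set, 'a) module"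
  where "enveloping_left_module K A =
    \<lparr>carrier = carrier A, monoid.mult = monoid.mult A, one = one A, ring.zero = ring.zero A, add = add A,
     smult = (\<lambda>t a. THE b. \<forall>f\<in>t. b =
       (\<Oplus>\<^bsub>A\<^esub>p\<in>fsupp K f. f p \<odot>\<^bsub>A\<^esub> (fst p \<otimes>\<^bsub>A\<^esub> a \<otimes>\<^bsub>A\<^esub> snd p)))\<rparr>"

definition enveloping_right_module ::
    "('k, 'm) ring_scheme \<Rightarrow> ('k, 'a, 'n) module_scheme \<Rightarrow> (('a \<times> 'a \<Rightarrow> 'k) set, 'a) module"
  where "enveloping_right_module K A =
    \<lparr>carrier = carrier A, monoid.mult = monoid.mult A, one = one A, ring.zero = ring.zero A, add = add A,
     smult = (\<lambda>t a. THE b. \<forall>f\<in>t. b =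
       (\<Oplus>\<^bsub>A\<^esub>p\<in>fsupp K f. f p \<odot>\<^bsub>A\<^esub> (snd p \<otimes>\<^bsub>A\<^esub> a \<otimes>\<^bsub>A\<^esub> fst p)))\<rparr>"

end

theory Submission
  imports Defs
begin

text \<open>The enveloping algebra \<open>A\<^sup>e = A \<otimes> A\<^bsup>op\<^esup>\<close> is isomorphic to its own opposite: the flip
  \<open>x \<otimes> y \<mapsto> y \<otimes> x\<close> reverses products, because
  \<open>(x \<otimes> y)(x' \<otimes> y') = xx' \<otimes> y'y\<close> is flipped to
  \<open>y'y \<otimes> xx' = (y' \<otimes> x')(y \<otimes> x)\<close>. Restriction of scalars along the flip therefore turns
  left \<open>A\<^sup>e\<close>-modules into right ones and conversely, without changing underlying groups or
  homomorphisms, so that it carries injective resolutions to injective resolutions of the same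
  length. Since \<open>a \<cdot> (x \<otimes> y) = yax = (y \<otimes> x) \<cdot> a\<close>, it exchanges \<open>A\<close> as a left and \<open>A\<close> as
  a right \<open>A\<^sup>e\<close>-module, and the two injective dimensions agree.

  The modules are handled for an arbitrary ring with involution
  (\<open>left_inj_dim_eq_right_inj_dim\<close>). The flip itself is defined on representatives, as
  precomposition with the exchange of coordinates on \<open>A \<times> A\<close>. It reverses convolution
  products (\<open>flip_mult\<close>) and permutes the bilinearity relations (\<open>flip_tensor_relations\<close>);
  as these generate the tensor ideal, it descends to the quotient
  (\<open>quotient_involution\<close>). Generated ideals and quotients behave as expected only in a ring,
  which is why \<open>K[A \<times> A\<^bsup>op\<^esup>]\<close> has to be shown to be one.\<close>

section \<open>The monoid algebra is a ring\<close>

locale monoid_algebra_data = K?: ring K + G?: monoid G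
  for K :: "('k, 'm) ring_scheme" and G :: "('g, 'n) monoid_scheme"
begin

abbreviation F where "F \<equiv> monoid_algebra K G"

lemma carrier_iff:
  "f \<in> carrier F \<longleftrightarrow>
     (\<forall>x. f x \<in> carrier K) \<and> finite (fsupp K f) \<and> fsupp K f \<subseteq> carrier G"
  by (auto simp: monoid_algebra_def)

lemma add_apply: "(f \<oplus>\<^bsub>F\<^esub> g) z = f z \<oplus>\<^bsub>K\<^esub> g z"
  by (simp add: monoid_algebra_def)

lemma zero_apply [simp]: "\<zero>\<^bsub>F\<^esub> z = \<zero>\<^bsub>K\<^esub>"
  by (simp add: monoid_algebra_def)

lemma one_eq: "\<one>\<^bsub>F\<^esub> = fsingle K \<one>\<^bsub>G\<^esub> \<one>\<^bsub>K\<^esub>"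
  by (simp add: monoid_algebra_def)

lemma fsupp_fsingle: "fsupp K (fsingle K g k) \<subseteq> {g}"
  by (auto simp: fsupp_def fsingle_def)

lemma fsingle_closed:
  assumes "g \<in> carrier G" "k \<in> carrier K"
  shows "fsingle K g k \<in> carrier F"
  using assms fsupp_fsingle[of g k]
  by (auto simp: carrier_iff fsingle_def intro: finite_subset)

lemma fsupp_add: "fsupp K (f \<oplus>\<^bsub>F\<^esub> g) \<subseteq> fsupp K f \<union> fsupp K g"
  by (auto simp: fsupp_def add_apply)

lemma add_in_carrier:
  assumes "f \<in> carrier F" "g \<in> carrier F"
  shows "f \<oplus>\<^bsub>F\<^esub> g \<in> carrier F"
  using assms fsupp_add[of f g] by (auto simp: carrier_iff add_apply intro: finite_subset)

lemma abelian_group: "abelian_group F"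
proof (rule abelian_groupI)
  fix f assume f: "f \<in> carrier F"
  have "fsupp K (\<lambda>z. \<ominus>\<^bsub>K\<^esub> f z) = fsupp K f"
    using f by (auto simp: fsupp_def carrier_iff)
  then have "(\<lambda>z. \<ominus>\<^bsub>K\<^esub> f z) \<in> carrier F"
    using f by (auto simp: carrier_iff)
  moreover have "(\<lambda>z. \<ominus>\<^bsub>K\<^esub> f z) \<oplus>\<^bsub>F\<^esub> f = \<zero>\<^bsub>F\<^esub>"
    using f by (intro ext) (auto simp: carrier_iff add_apply K.l_neg)
  ultimately show "\<exists>y\<in>carrier F. y \<oplus>\<^bsub>F\<^esub> f = \<zero>\<^bsub>F\<^esub>" by blast
next
  show "\<zero>\<^bsub>F\<^esub> \<in> carrier F"
    by (auto simp: carrier_iff fsupp_def)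
next
  show "f \<oplus>\<^bsub>F\<^esub> g \<in> carrier F" if "f \<in> carrier F" "g \<in> carrier F" for f g
    using that by (rule add_in_carrier)
qed (auto simp: carrier_iff add_apply K.a_ac intro!: ext)

text \<open>Enlarging the index sets beyond the supports puts the convolutions of several functions
  over one common index set; sums can then be compared term by term.\<close>

lemma mult_apply:
  assumes "f \<in> carrier F" "g \<in> carrier F"
    and "finite S" "finite T" "fsupp K f \<subseteq> S" "fsupp K g \<subseteq> T"
  shows "(f \<otimes>\<^bsub>F\<^esub> g) z =
    (\<Oplus>\<^bsub>K\<^esub>p\<in>S \<times> T. if fst p \<otimes>\<^bsub>G\<^esub> snd p = z then f (fst p) \<otimes>\<^bsub>K\<^esub> g (snd p) else \<zero>\<^bsub>K\<^esub>)"
proof -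
  have "(f \<otimes>\<^bsub>F\<^esub> g) z =
      (\<Oplus>\<^bsub>K\<^esub>p \<in> {p \<in> fsupp K f \<times> fsupp K g. fst p \<otimes>\<^bsub>G\<^esub> snd p = z}. f (fst p) \<otimes>\<^bsub>K\<^esub> g (snd p))"
    by (simp add: monoid_algebra_def)
  also have "\<dots> = (\<Oplus>\<^bsub>K\<^esub>p\<in>S \<times> T. if fst p \<otimes>\<^bsub>G\<^esub> snd p = z
      then f (fst p) \<otimes>\<^bsub>K\<^esub> g (snd p) else \<zero>\<^bsub>K\<^esub>)"
    using assms
    by (intro K.add.finprod_mono_neutral_cong_left) (auto simp: carrier_iff fsupp_def)
  finally show ?thesis .
qed

lemma mult_closed:
  assumes f: "f \<in> carrier F" and g: "g \<in> carrier F"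
  shows "f \<otimes>\<^bsub>F\<^esub> g \<in> carrier F"
proof -
  let ?P = "(\<lambda>p. fst p \<otimes>\<^bsub>G\<^esub> snd p) ` (fsupp K f \<times> fsupp K g)"
  have fin: "finite (fsupp K f)" "finite (fsupp K g)"
    and sub: "fsupp K f \<subseteq> carrier G" "fsupp K g \<subseteq> carrier G"
    using f g by (auto simp: carrier_iff)
  note eq = mult_apply[OF f g fin order_refl order_refl]
  have "(f \<otimes>\<^bsub>F\<^esub> g) z \<in> carrier K" for z
    unfolding eq using f g by (intro K.finsum_closed) (auto simp: carrier_iff)
  moreover have "fsupp K (f \<otimes>\<^bsub>F\<^esub> g) \<subseteq> ?P"
  proof
    fix z assume z: "z \<in> fsupp K (f \<otimes>\<^bsub>F\<^esub> g)"
    show "z \<in> ?P"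
    proof (rule ccontr)
      assume "z \<notin> ?P"
      then have "(f \<otimes>\<^bsub>F\<^esub> g) z = \<zero>\<^bsub>K\<^esub>"
        unfolding eq by (intro K.add.finprod_one_eqI) force
      then show False using z by (simp add: fsupp_def)
    qed
  qed
  moreover have "finite ?P" "?P \<subseteq> carrier G"
    using fin sub by (auto simp: subset_iff)
  ultimately show ?thesis
    by (meson carrier_iff finite_subset subset_trans)
qed

lemma l_distr:
  assumes "f \<in> carrier F" "f' \<in> carrier F" "g \<in> carrier F"
  shows "(f \<oplus>\<^bsub>F\<^esub> f') \<otimes>\<^bsub>F\<^esub> g = f \<otimes>\<^bsub>F\<^esub> g \<oplus>\<^bsub>F\<^esub> f' \<otimes>\<^bsub>F\<^esub> g"
proof
  fix z
  let ?S = "fsupp K f \<union> fsupp K f'" and ?T = "fsupp K g"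
  have fin: "finite ?S" "finite ?T"
    using assms by (auto simp: carrier_iff)
  have cl: "f x \<in> carrier K" "f' x \<in> carrier K" "g x \<in> carrier K" for x
    using assms by (auto simp: carrier_iff)
  show "((f \<oplus>\<^bsub>F\<^esub> f') \<otimes>\<^bsub>F\<^esub> g) z = (f \<otimes>\<^bsub>F\<^esub> g \<oplus>\<^bsub>F\<^esub> f' \<otimes>\<^bsub>F\<^esub> g) z"
    using assms fsupp_add[of f f'] fin cl
    by (simp add: mult_apply[where S = ?S and T = ?T] add_in_carrier add_apply
        K.finsum_addf[symmetric] Pi_def del: K.finsum_addf)
      (intro K.add.finprod_cong', auto simp: K.l_distr add_apply)
qed

lemma r_distr:
  assumes "f \<in> carrier F" "g \<in> carrier F" "g' \<in> carrier F"
  shows "f \<otimes>\<^bsub>F\<^esub> (g \<oplus>\<^bsub>F\<^esub> g') = f \<otimes>\<^bsub>F\<^esub> g \<oplus>\<^bsub>F\<^esub> f \<otimes>\<^bsub>F\<^esub> g'"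
proof
  fix z
  let ?S = "fsupp K f" and ?T = "fsupp K g \<union> fsupp K g'"
  have fin: "finite ?S" "finite ?T"
    using assms by (auto simp: carrier_iff)
  have cl: "f x \<in> carrier K" "g' x \<in> carrier K" "g x \<in> carrier K" for x
    using assms by (auto simp: carrier_iff)
  show "(f \<otimes>\<^bsub>F\<^esub> (g \<oplus>\<^bsub>F\<^esub> g')) z = (f \<otimes>\<^bsub>F\<^esub> g \<oplus>\<^bsub>F\<^esub> f \<otimes>\<^bsub>F\<^esub> g') z"
    using assms fsupp_add[of g g'] fin cl
    by (simp add: mult_apply[where S = ?S and T = ?T] add_in_carrier add_apply
        K.finsum_addf[symmetric] Pi_def del: K.finsum_addf)
      (intro K.add.finprod_cong', auto simp: K.r_distr add_apply)
qed

lemma fsingle_mult: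
  assumes "a \<in> carrier G" "b \<in> carrier G" "k \<in> carrier K" "l \<in> carrier K"
  shows "fsingle K a k \<otimes>\<^bsub>F\<^esub> fsingle K b l = fsingle K (a \<otimes>\<^bsub>G\<^esub> b) (k \<otimes>\<^bsub>K\<^esub> l)"
proof
  fix z
  show "(fsingle K a k \<otimes>\<^bsub>F\<^esub> fsingle K b l) z = fsingle K (a \<otimes>\<^bsub>G\<^esub> b) (k \<otimes>\<^bsub>K\<^esub> l) z"
    using assms
    by (subst mult_apply[where S = "{a}" and T = "{b}"])
      (auto simp: fsingle_closed fsupp_fsingle, auto simp: fsingle_def)
qed

text \<open>The formal multiples \<open>k\<cdot>g\<close> span the monoid algebra additively, so that identities that are
  additive in each variable need only be checked on them.\<close>

lemma carrier_induct [consumes 1, case_names single add]: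
  assumes "f \<in> carrier F"
    and single: "\<And>g k. \<lbrakk>g \<in> carrier G; k \<in> carrier K\<rbrakk> \<Longrightarrow> P (fsingle K g k)"
    and add: "\<And>f g. \<lbrakk>f \<in> carrier F; g \<in> carrier F; P f; P g\<rbrakk> \<Longrightarrow> P (f \<oplus>\<^bsub>F\<^esub> g)"
  shows "P f"
proof -
  have "finite S \<Longrightarrow> f \<in> carrier F \<Longrightarrow> fsupp K f \<subseteq> S \<Longrightarrow> P f" for S f
  proof (induction S arbitrary: f rule: finite_induct)
    case empty
    then have "f = fsingle K \<one>\<^bsub>G\<^esub> \<zero>\<^bsub>K\<^esub>"
      by (auto simp: fsupp_def fsingle_def)
    then show ?case by (simp add: single)
  next
    case (insert g S)
    show ?case
    proof (cases "g \<in> fsupp K f")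
      case False
      then show ?thesis using insert by blast
    next
      case True
      let ?r = "f(g := \<zero>\<^bsub>K\<^esub>)"
      have cl: "f x \<in> carrier K" for x
        using insert.prems by (simp add: carrier_iff)
      have supp: "fsupp K ?r = fsupp K f - {g}"
        by (auto simp: fsupp_def)
      have r: "?r \<in> carrier F"
        using insert.prems by (auto simp: carrier_iff supp)
      have g: "g \<in> carrier G"
        using True insert.prems by (auto simp: carrier_iff)
      have "f = fsingle K g (f g) \<oplus>\<^bsub>F\<^esub> ?r"
        using cl by (intro ext) (simp add: fsingle_def add_apply)
      moreover have "P ?r"
        using insert.prems(2) by (intro insert.IH r) (auto simp only: supp)
      ultimately show ?thesis
        using add[OF fsingle_closed[OF g cl] r single[OF g cl]] by metis
    qed
  qed
  then show ?thesis
    using assms(1) by (auto simp: carrier_iff)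
qed

lemma mult_assoc:
  assumes "f \<in> carrier F" "g \<in> carrier F" "h \<in> carrier F"
  shows "(f \<otimes>\<^bsub>F\<^esub> g) \<otimes>\<^bsub>F\<^esub> h = f \<otimes>\<^bsub>F\<^esub> (g \<otimes>\<^bsub>F\<^esub> h)"
  using assms
proof (induction f rule: carrier_induct)
  case (add f f')
  then show ?case by (simp add: l_distr mult_closed)
next
  case (single a k)
  note a = this(1,2)
  show ?case using single(3,4)
  proof (induction g rule: carrier_induct)
    case (add g g')
    then show ?case by (simp add: a l_distr r_distr mult_closed fsingle_closed)
  next
    case (single b l)
    note b = this(1,2)
    show ?case using single(3)
    proof (induction h rule: carrier_induct)
      case (add h h')
      then show ?case by (simp add: a b r_distr mult_closed fsingle_closed)
    next
      case (single c m)
      then show ?case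
        by (simp add: a b fsingle_mult K.m_assoc G.m_assoc)
    qed
  qed
qed

lemma one_closed: "\<one>\<^bsub>F\<^esub> \<in> carrier F"
  by (simp add: one_eq fsingle_closed)

lemma ring: "ring F"
proof (rule ringI[OF abelian_group], rule monoidI)
  fix f assume "f \<in> carrier F"
  then show "\<one>\<^bsub>F\<^esub> \<otimes>\<^bsub>F\<^esub> f = f"
    by (induction f rule: carrier_induct)
      (simp_all add: one_closed r_distr, simp add: one_eq fsingle_mult)
next
  fix f assume "f \<in> carrier F"
  then show "f \<otimes>\<^bsub>F\<^esub> \<one>\<^bsub>F\<^esub> = f"
    by (induction f rule: carrier_induct)
      (simp_all add: one_closed l_distr, simp add: one_eq fsingle_mult)
qed (simp_all add: mult_closed one_closed mult_assoc l_distr r_distr)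

end


section \<open>Involutions of rings\<close>

locale ring_involution = ring R for R :: "('r, 'm) ring_scheme" (structure) +
  fixes \<sigma> :: "'r \<Rightarrow> 'r"
  assumes invol [simp]: "\<sigma> (\<sigma> x) = x"
    and closed [simp]: "x \<in> carrier R \<Longrightarrow> \<sigma> x \<in> carrier R"
    and add: "\<lbrakk>x \<in> carrier R; y \<in> carrier R\<rbrakk> \<Longrightarrow> \<sigma> (x \<oplus> y) = \<sigma> x \<oplus> \<sigma> y"
    and mult: "\<lbrakk>x \<in> carrier R; y \<in> carrier R\<rbrakk> \<Longrightarrow> \<sigma> (x \<otimes> y) = \<sigma> y \<otimes> \<sigma> x"
begin

lemma one: "\<sigma> \<one> = \<one>"
proof -
  have "\<sigma> (\<one> \<otimes> \<sigma> \<one>) = \<one> \<otimes> \<sigma> \<one>"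
    by (subst mult) auto
  then show ?thesis by simp
qed

lemma zero: "\<sigma> \<zero> = \<zero>"
proof -
  have "\<sigma> \<zero> \<oplus> \<sigma> \<zero> = \<sigma> \<zero>"
    by (metis add l_zero zero_closed)
  then show ?thesis by (simp add: add.l_cancel_one)
qed

lemma uminus: "x \<in> carrier R \<Longrightarrow> \<sigma> (\<ominus> x) = \<ominus> \<sigma> x"
  by (rule minus_equality[symmetric]) (simp_all add: add[symmetric] l_neg zero)

lemma minus: "\<lbrakk>x \<in> carrier R; y \<in> carrier R\<rbrakk> \<Longrightarrow> \<sigma> (x \<ominus> y) = \<sigma> x \<ominus> \<sigma> y"
  by (simp add: a_minus_def add uminus)

lemma mem_image_iff: "x \<in> \<sigma> ` S \<longleftrightarrow> \<sigma> x \<in> S"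
  by (metis imageI imageE invol)

lemma ideal_image:
  assumes "ideal J R"
  shows "ideal (\<sigma> ` J) R"
proof -
  interpret J: ideal J R by fact
  have cl: "\<sigma> x \<in> J \<Longrightarrow> x \<in> carrier R" for x
    using J.Icarr closed invol by metis
  have ne: "J \<noteq> {}"
    using additive_subgroup.zero_closed[OF J.additive_subgroup_axioms] by blast
  show ?thesis
  proof (rule idealI[OF ring_axioms])
    show "subgroup (\<sigma> ` J) (add_monoid R)"
      by (rule add.subgroupI)
        (use ne in \<open>auto simp: mem_image_iff cl add uminus simp flip: a_inv_def\<close>)
    show "x \<otimes> a \<in> \<sigma> ` J" "a \<otimes> x \<in> \<sigma> ` J" if "a \<in> \<sigma> ` J" "x \<in> carrier R" for a x
      using that by (auto simp: mem_image_iff mult J.I_l_closed J.I_r_closed cl)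
  qed
qed

text \<open>The image of \<open>Idl S\<close> is an ideal containing \<open>S\<close>, hence contains \<open>Idl S\<close>; applying
  \<open>\<sigma>\<close> once more gives the reverse inclusion.\<close>

lemma genideal_image:
  assumes S: "S \<subseteq> carrier R" and inv: "\<And>x. x \<in> S \<Longrightarrow> \<sigma> x \<in> S"
  shows "\<sigma> ` (Idl S) = Idl S"
proof -
  have "S \<subseteq> \<sigma> ` (Idl S)"
    using genideal_self[OF S] inv by (auto simp: mem_image_iff subset_iff)
  then have "Idl S \<subseteq> \<sigma> ` (Idl S)"
    by (intro genideal_minimal ideal_image genideal_ideal S)
  moreover from image_mono[OF this, of \<sigma>] have "\<sigma> ` (Idl S) \<subseteq> Idl S"
    by (simp add: image_image)
  ultimately show ?thesis by blast
qed

lemma coset_image: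
  assumes "J \<subseteq> carrier R" "\<sigma> ` J = J" "x \<in> carrier R"
  shows "\<sigma> ` (J +> x) = J +> \<sigma> x"
proof -
  have "\<sigma> ` (J +> x) = (\<lambda>j. \<sigma> j \<oplus> \<sigma> x) ` J"
    using assms by (force simp: a_r_coset_def' add)
  also have "\<dots> = (\<lambda>j. j \<oplus> \<sigma> x) ` (\<sigma> ` J)"
    by (simp add: image_image)
  finally show ?thesis
    using assms(2) by (auto simp: a_r_coset_def')
qed

text \<open>On a coset, taken as a set of representatives, the induced involution is the direct image. This
  choice makes it an involution on all sets and not only on cosets, as the locale demands.\<close>

lemma quotient_involution:
  assumes "ideal J R" and J: "\<sigma> ` J = J"
  shows "ring_involution (R Quot J) ((`) \<sigma>)"
proof -
  interpret J: ideal J R by fact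
  interpret Q: ring "R Quot J" by (rule J.quotient_is_ring)
  have sub: "J \<subseteq> carrier R" using J.Icarr by blast
  note coset = coset_image[OF sub J]
  have carr: "U \<in> carrier (R Quot J) \<longleftrightarrow> (\<exists>x\<in>carrier R. U = J +> x)" for U
    by (auto simp: FactRing_def A_RCOSETS_def')
  show ?thesis
  proof
    show "\<sigma> ` \<sigma> ` U = U" for U by (simp add: image_image)
  next
    fix U assume "U \<in> carrier (R Quot J)"
    then show "\<sigma> ` U \<in> carrier (R Quot J)" by (auto simp: carr coset) (use closed in blast)
  next
    fix U V assume "U \<in> carrier (R Quot J)" "V \<in> carrier (R Quot J)"
    then obtain x y where xy: "x \<in> carrier R" "y \<in> carrier R" "U = J +> x" "V = J +> y"
      by (auto simp: carr)
    show "\<sigma> ` (U \<oplus>\<^bsub>R Quot J\<^esub> V) = \<sigma> ` U \<oplus>\<^bsub>R Quot J\<^esub> \<sigma> ` V"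
      using xy by (simp add: FactRing_def J.a_rcos_sum coset add)
    show "\<sigma> ` (U \<otimes>\<^bsub>R Quot J\<^esub> V) = \<sigma> ` V \<otimes>\<^bsub>R Quot J\<^esub> \<sigma> ` U"
      using xy by (simp add: FactRing_def J.rcoset_mult_add coset mult)
  qed
qed

end


section \<open>Exchanging left and right modules\<close>

text \<open>Restriction of scalars along \<open>\<sigma>\<close>. Since \<open>\<sigma>\<close> reverses products, it turns left modules into
  right ones and conversely. An involution \<open>\<sigma>\<close> makes it an involution on module records, which
  are then in an exact bijection.\<close>

definition twist :: "('r \<Rightarrow> 'r) \<Rightarrow> ('r, 'x) module \<Rightarrow> ('r, 'x) module"
  where "twist \<sigma> M = M\<lparr>smult := \<lambda>r. smult M (\<sigma> r)\<rparr>"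

lemma twist_simps [simp]:
  "carrier (twist \<sigma> M) = carrier M" "add (twist \<sigma> M) = add M" "ring.zero (twist \<sigma> M) = ring.zero M"
  "smult (twist \<sigma> M) r = smult M (\<sigma> r)"
  by (simp_all add: twist_def)

lemma abelian_group_twist: "abelian_group M \<Longrightarrow> abelian_group (twist \<sigma> M)"
  by (simp add: abelian_group_def abelian_monoid_def abelian_group_axioms_def)

context ring_involution
begin

lemma twist_twist: "twist \<sigma> (twist \<sigma> M) = M"
  by (simp add: twist_def)

lemma right_module_twist:
  assumes "left_module R M"
  shows "right_module R (twist \<sigma> M)"
proof -
  interpret M: left_module R M by fact
  show ?thesis
    using abelian_group_twist[OF M.M.abelian_group_axioms]
    by (intro right_module.intro right_module_axioms.intro)
      (auto simp: ring_axioms add mult one M.smult_closed M.smult_add_ring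
        M.smult_add_module M.smult_assoc M.smult_one)
qed

lemma left_module_twist:
  assumes "right_module R M"
  shows "left_module R (twist \<sigma> M)"
proof -
  interpret M: right_module R M by fact
  show ?thesis
    using abelian_group_twist[OF M.M.abelian_group_axioms]
    by (intro left_module.intro left_module_axioms.intro)
      (auto simp: ring_axioms add mult one M.smult_closed M.smult_add_ring
        M.smult_add_module M.smult_assoc M.smult_one)
qed

lemma module_hom_twist:
  "f \<in> module_hom R M N \<Longrightarrow> f \<in> module_hom R (twist \<sigma> M) (twist \<sigma> N)"
  by (auto simp: module_hom_def)

lemma module_hom_twist_iff:
  "f \<in> module_hom R (twist \<sigma> M) N \<longleftrightarrow> f \<in> module_hom R M (twist \<sigma> N)"
  by (metis module_hom_twist twist_twist)

text \<open>\<open>C\<close> and \<open>C'\<close> stand for left and right modules in either order. An extension problem for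
  \<open>twist \<sigma> I\<close> becomes one for \<open>I\<close> after twisting its two test modules, and the extension
  found there solves the original problem, because the twist preserves homomorphisms.\<close>

lemma injective_in_twist:
  assumes "injective_in C R I"
    and C: "\<And>M. C M \<Longrightarrow> C' (twist \<sigma> M)" and C': "\<And>M. C' M \<Longrightarrow> C (twist \<sigma> M)"
  shows "injective_in C' R (twist \<sigma> I)"
  unfolding injective_in_def
proof (intro conjI allI impI)
  show "C' (twist \<sigma> I)"
    using assms by (simp add: injective_in_def)
next
  fix M N f g
  assume A: "C' M \<and> C' N \<and> f \<in> module_hom R M N \<and> inj_on f (carrier M)
    \<and> g \<in> module_hom R M (twist \<sigma> I)"
  then have "C (twist \<sigma> M) \<and> C (twist \<sigma> N) \<and> f \<in> module_hom R (twist \<sigma> M) (twist \<sigma> N)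
      \<and> inj_on f (carrier (twist \<sigma> M)) \<and> g \<in> module_hom R (twist \<sigma> M) I"
    by (auto intro: C' module_hom_twist iffD2[OF module_hom_twist_iff])
  then have "\<exists>h\<in>module_hom R (twist \<sigma> N) I. \<forall>x\<in>carrier (twist \<sigma> M). h (f x) = g x"
    using assms(1) unfolding injective_in_def by blast
  then show "\<exists>h\<in>module_hom R N (twist \<sigma> I). \<forall>x\<in>carrier M. h (f x) = g x"
    using module_hom_twist_iff[of _ N I] by auto
qed

text \<open>Twisting every term of an injective resolution preserves exactness, as the maps stay the same.
  \<open>M'\<close> agrees with \<open>twist \<sigma> M\<close> on the carriers instead of being equal to it, because scalar
  multiplications given by definite descriptions are only controlled there.\<close>

lemma inj_dim_in_twist_le:
  fixes M M' :: "('r, 'x) module"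
  assumes C: "\<And>M. C M \<Longrightarrow> C' (twist \<sigma> M)" and C': "\<And>M. C' M \<Longrightarrow> C (twist \<sigma> M)"
    and M': "carrier M' = carrier M" "add M' = add M"
      "\<And>r x. \<lbrakk>r \<in> carrier R; x \<in> carrier M\<rbrakk> \<Longrightarrow> r \<odot>\<^bsub>M'\<^esub> x = \<sigma> r \<odot>\<^bsub>M\<^esub> x"
  shows "inj_dim_in C' R M' \<le> inj_dim_in C R M"
  unfolding inj_dim_in_def
proof (rule Inf_superset_mono, clarify)
  fix n I \<epsilon> d
  assume res: "injective_resolution C R M I \<epsilon> d" and fin: "\<forall>i>n. carrier (I i) = {\<zero>\<^bsub>I i\<^esub>}"
  let ?I = "\<lambda>i. twist \<sigma> (I i)"
  have "\<epsilon> \<in> module_hom R M' (?I 0)"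
    using res M' by (auto simp: injective_resolution_def module_hom_def)
  moreover have "injective_in C' R (?I i)" for i
    using res by (intro injective_in_twist[of C _ C'] C C') (simp add: injective_resolution_def)
  ultimately have "injective_resolution C' R M' ?I \<epsilon> d"
    using res by (simp add: injective_resolution_def a_kernel_def' M'(1) module_hom_twist)
  then show "\<exists>m. enat n = enat m \<and> (\<exists>I \<epsilon> d. injective_resolution C' R M' I \<epsilon> d
      \<and> (\<forall>i>m. carrier (I i) = {\<zero>\<^bsub>I i\<^esub>}))"
    using fin by (intro exI[of _ n] conjI refl exI[of _ ?I] exI[of _ \<epsilon>] exI[of _ d]) simp_all
qed

theorem left_inj_dim_eq_right_inj_dim:
  fixes M M' :: "('r, 'x) module"
  assumes M': "carrier M' = carrier M" "add M' = add M"
    and smult: "\<And>r x. \<lbrakk>r \<in> carrier R; x \<in> carrier M\<rbrakk> \<Longrightarrow> r \<odot>\<^bsub>M'\<^esub> x = \<sigma> r \<odot>\<^bsub>M\<^esub> x"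
  shows "left_inj_dim R M = right_inj_dim R M'"
  unfolding left_inj_dim_def right_inj_dim_def
proof (rule antisym)
  show "inj_dim_in (left_module R) R M \<le> inj_dim_in (right_module R) R M'"
    by (rule inj_dim_in_twist_le) (simp_all add: left_module_twist right_module_twist M' smult)
  show "inj_dim_in (right_module R) R M' \<le> inj_dim_in (left_module R) R M"
    by (rule inj_dim_in_twist_le) (simp_all add: left_module_twist right_module_twist M' smult)
qed

end


section \<open>The flip of the enveloping algebra\<close>

lemma opposite_simps [simp]:
  "carrier (opposite R) = carrier R" "one (opposite R) = one R" "add (opposite R) = add R"
  "x \<otimes>\<^bsub>opposite R\<^esub> y = y \<otimes>\<^bsub>R\<^esub> x"
  by (simp_all add: opposite_def)

lemma smult_opposite [simp]: "smult (opposite A) = smult A"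
  by (simp add: opposite_def)

context K_algebra
begin

abbreviation E where "E \<equiv> monoid_algebra K (A \<times>\<times> opposite A)"

abbreviation flip :: "('c \<times> 'c \<Rightarrow> 'k) \<Rightarrow> 'c \<times> 'c \<Rightarrow> 'k"
  where "flip f \<equiv> f \<circ> prod.swap"

lemma monoid_opposite: "monoid (opposite A)"
  by (rule monoidI) (simp_all add: A.m_assoc)

sublocale E: monoid_algebra_data K "A \<times>\<times> opposite A"
  by (intro monoid_algebra_data.intro DirProd_monoid monoid_opposite
      A.monoid_axioms K.ring_axioms)

lemma fsupp_flip: "fsupp K (flip f) = prod.swap ` fsupp K f"
  by (force simp: fsupp_def)

lemma flip_fsingle: "flip (fsingle K (a, b) k) = fsingle K (b, a) k"
  by (auto simp: fsingle_def fun_eq_iff)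

lemma flip_closed: "f \<in> carrier E \<Longrightarrow> flip f \<in> carrier E"
  by (auto simp: E.carrier_iff fsupp_flip)

lemma flip_add: "flip (f \<oplus>\<^bsub>E\<^esub> g) = flip f \<oplus>\<^bsub>E\<^esub> flip g"
  by (rule ext) (simp add: E.add_apply)

lemma swap_mult:
  "prod.swap (p \<otimes>\<^bsub>A \<times>\<times> opposite A\<^esub> q) =
     prod.swap q \<otimes>\<^bsub>A \<times>\<times> opposite A\<^esub> prod.swap p"
  by (simp add: mult_DirProd')

text \<open>The pair \<open>(p, q)\<close> contributes to the left-hand side where the exchanged pair of swapped
  elements contributes to the right-hand side; commutativity of \<open>K\<close> equates the two
  contributions.\<close>

lemma flip_mult:
  assumes f: "f \<in> carrier E" and g: "g \<in> carrier E"
  shows "flip (f \<otimes>\<^bsub>E\<^esub> g) = flip g \<otimes>\<^bsub>E\<^esub> flip f"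
proof
  fix z
  let ?S = "fsupp K f" and ?T = "fsupp K g" and ?m = "\<lambda>p q. p \<otimes>\<^bsub>A \<times>\<times> opposite A\<^esub> q"
  let ?h = "\<lambda>p. (prod.swap (snd p), prod.swap (fst p))"
  let ?u = "\<lambda>p. if ?m (fst p) (snd p) = z
      then flip g (fst p) \<otimes>\<^bsub>K\<^esub> flip f (snd p) else \<zero>\<^bsub>K\<^esub>"
  have fin: "finite ?S" "finite ?T"
    using f g by (auto simp: E.carrier_iff)
  have cl: "f x \<in> carrier K" "g x \<in> carrier K" for x
    using f g unfolding E.carrier_iff by blast+
  have im: "fsupp K (flip g) \<times> fsupp K (flip f) = ?h ` (?S \<times> ?T)"
    by (force simp: fsupp_flip)
  have "(flip g \<otimes>\<^bsub>E\<^esub> flip f) z = (\<Oplus>\<^bsub>K\<^esub>p\<in>fsupp K (flip g) \<times> fsupp K (flip f). ?u p)"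
    using fin by (intro E.mult_apply flip_closed f g) (simp_all add: fsupp_flip)
  also have "\<dots> = (\<Oplus>\<^bsub>K\<^esub>p\<in>?S \<times> ?T. ?u (?h p))"
    unfolding im by (rule K.add.finprod_reindex) (auto simp: inj_on_def cl)
  also have "\<dots> = (\<Oplus>\<^bsub>K\<^esub>p\<in>?S \<times> ?T. if ?m (fst p) (snd p) = prod.swap z
      then f (fst p) \<otimes>\<^bsub>K\<^esub> g (snd p) else \<zero>\<^bsub>K\<^esub>)"
  proof (rule K.add.finprod_cong')
    fix p
    have "?m (prod.swap (snd p)) (prod.swap (fst p)) = z
        \<longleftrightarrow> ?m (fst p) (snd p) = prod.swap z"
      by (metis swap_mult swap_swap)
    then show "?u (?h p) = (if ?m (fst p) (snd p) = prod.swap z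
        then f (fst p) \<otimes>\<^bsub>K\<^esub> g (snd p) else \<zero>\<^bsub>K\<^esub>)"
      by (simp add: K.m_comm cl)
  qed (auto simp: cl)
  also have "\<dots> = (f \<otimes>\<^bsub>E\<^esub> g) (prod.swap z)"
    using fin by (simp add: E.mult_apply[OF f g])
  finally show "flip (f \<otimes>\<^bsub>E\<^esub> g) z = (flip g \<otimes>\<^bsub>E\<^esub> flip f) z"
    by simp
qed

sublocale flip: ring_involution E flip
proof (rule ring_involution.intro[OF E.ring], unfold_locales)
  show "flip (flip f) = f" for f :: "'b \<times> 'b \<Rightarrow> 'k"
    by (simp add: fun_eq_iff)
qed (simp_all add: flip_closed flip_mult flip_add)

lemma tensor_relations_closed: "tensor_relations K A (opposite A) \<subseteq> carrier E"
  by (auto simp: tensor_relations_def Let_def E.fsingle_closed)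

text \<open>The flip exchanges additivity in the first with additivity in the second tensor factor, and
  likewise for homogeneity.\<close>

lemma flip_tensor_relations:
  assumes "x \<in> tensor_relations K A (opposite A)"
  shows "flip x \<in> tensor_relations K A (opposite A)"
  using assms unfolding tensor_relations_def Let_def
  by (elim UnE CollectE exE conjE)
    (simp_all add: flip.minus flip.add flip_fsingle E.fsingle_closed, blast+)

lemma tensor_ideal: "ideal (tensor_ideal K A (opposite A)) E"
  unfolding tensor_ideal_def by (rule flip.genideal_ideal[OF tensor_relations_closed])

lemma enveloping_involution: "ring_involution (enveloping_algebra K A) ((`) flip)"
  unfolding enveloping_algebra_def tensor_algebra_def
  using tensor_ideal flip.genideal_image[OF tensor_relations_closed flip_tensor_relations]
  by (intro flip.quotient_involution) (simp_all add: tensor_ideal_def)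

lemma enveloping_carrier_subset:
  assumes "t \<in> carrier (enveloping_algebra K A)" "f \<in> t"
  shows "f \<in> carrier E"
proof -
  interpret J: ideal "tensor_ideal K A (opposite A)" E by (rule tensor_ideal)
  show ?thesis
    using assms J.a_rcosets_carrier
    by (auto simp: enveloping_algebra_def tensor_algebra_def FactRing_def)
qed

text \<open>For each representative of \<open>t\<close> the candidate value of the right action is the one that the
  flipped representative gives for the left action. The two definite descriptions thus have
  equivalent defining properties.\<close>

lemma enveloping_smult_flip:
  assumes t: "t \<in> carrier (enveloping_algebra K A)" and a: "a \<in> carrier A"
  shows "t \<odot>\<^bsub>enveloping_right_module K A\<^esub> a = (flip ` t) \<odot>\<^bsub>enveloping_left_module K A\<^esub> a"
proof -
  let ?u = "\<lambda>f p. f p \<odot>\<^bsub>A\<^esub> (fst p \<otimes>\<^bsub>A\<^esub> a \<otimes>\<^bsub>A\<^esub> snd p)"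
  have "(\<Oplus>\<^bsub>A\<^esub>p\<in>fsupp K (flip f). ?u (flip f) p) =
      (\<Oplus>\<^bsub>A\<^esub>p\<in>fsupp K f. f p \<odot>\<^bsub>A\<^esub> (snd p \<otimes>\<^bsub>A\<^esub> a \<otimes>\<^bsub>A\<^esub> fst p))" if "f \<in> t" for f
  proof -
    have f: "f \<in> carrier E"
      using enveloping_carrier_subset[OF t that] .
    have "f p \<in> carrier K" for p
      using f unfolding E.carrier_iff by blast
    moreover have "fsupp K f \<subseteq> carrier A \<times> carrier A"
      using f by (simp add: E.carrier_iff)
    ultimately have "?u (flip f) \<in> prod.swap ` fsupp K f \<rightarrow> carrier A"
      using a by (auto intro!: smult_closed)
    then show ?thesis
      by (simp add: fsupp_flip A.add.finprod_reindex)
  qed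
  then show ?thesis
    by (simp add: enveloping_left_module_def enveloping_right_module_def)
qed

end

theorem proposition5p7:
  fixes K :: "('k, 'm) ring_scheme" and A :: "('k, 'a, 'n) module_scheme"
  assumes "algebraically_closed K"
    and "fin_dim_K_algebra K A"
  shows "left_inj_dim (enveloping_algebra K A) (enveloping_left_module K A) =
         right_inj_dim (enveloping_algebra K A) (enveloping_right_module K A)"
proof -
  interpret fin_dim_K_algebra K A by fact
  interpret involution: ring_involution "enveloping_algebra K A" "(`) flip"
    by (rule enveloping_involution)
  show ?thesis
    by (rule involution.left_inj_dim_eq_right_inj_dim)
      (simp_all add: enveloping_left_module_def enveloping_right_module_def
        enveloping_smult_flip[unfolded enveloping_left_module_def enveloping_right_module_def, simplified])
qed

end
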